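(* Let $\mathbf{P}=(P_w)_{w\in\mathcal{W}}$ and $\mathbf{Q}=(Q_w)_{w\in\mathcal{W}}$ be any two probability distributions on a finite set $\mathcal{W}$. Let $\zeta\sim U[0,1]$ and let $w$ be sampled by the maximal coupling procedure (defined in the context) with inputs $\mathbf{P},\mathbf{Q},\zeta$. Then $w\sim\mathbf{P}$.
   Context: Maximal coupling procedure. Given distributions $\mathbf{P},\mathbf{Q}$ on a finite set $\mathcal{W}$ and $\zeta\in[0,1]$, compute $p=\sum_{v\in\mathcal{W}}\min(P_v,Q_v)$. If $\zeta\le p$, sample $w$ from the normalized overlap distribution, i.e. the distribution on $\mathcal{W}$ proportional to $v\mapsto\min(P_v,Q_v)$. If $\zeta>p$, sample $w$ from the normalized excess distribution, i.e. the distribution proportional to $v\mapsto\max(0,P_v-Q_v)$. Return $w$. The sampling randomness is independent of $\zeta$. (If $p=0$ or $p=1$, the case whose distribution cannot be normalized occurs with probability zero and the choice there is irrelevant.) *)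

theory Defs
  imports "HOL-Probability.Probability"
begin

definition overlap_mass :: "'w set \<Rightarrow> 'w pmf \<Rightarrow> 'w pmf \<Rightarrow> real" where
  "overlap_mass W P Q = (\<Sum>v\<in>W. min (pmf P v) (pmf Q v))"

text \<open>
  The distribution on \<open>W\<close> proportional to the nonnegative weights \<open>f\<close>. It is an unspecified
  \<open>pmf\<close> if the weights sum to zero.
\<close>
definition normalized_pmf :: "'w set \<Rightarrow> ('w \<Rightarrow> real) \<Rightarrow> 'w pmf" where
  "normalized_pmf W f = embed_pmf (\<lambda>v. if v \<in> W then f v / (\<Sum>u\<in>W. f u) else 0)"

definition overlap_pmf :: "'w set \<Rightarrow> 'w pmf \<Rightarrow> 'w pmf \<Rightarrow> 'w pmf" where
  "overlap_pmf W P Q = normalized_pmf W (\<lambda>v. min (pmf P v) (pmf Q v))"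

definition excess_pmf :: "'w set \<Rightarrow> 'w pmf \<Rightarrow> 'w pmf \<Rightarrow> 'w pmf" where
  "excess_pmf W P Q = normalized_pmf W (\<lambda>v. max 0 (pmf P v - pmf Q v))"

text \<open>
  The output distribution of the procedure run on the fixed input \<open>z\<close>, i.e. with \<open>P\<close>, \<open>Q\<close>, \<open>z\<close>
  given and only the sampling step random.
\<close>
definition maximal_coupling :: "'w set \<Rightarrow> 'w pmf \<Rightarrow> 'w pmf \<Rightarrow> real \<Rightarrow> 'w pmf" where
  "maximal_coupling W P Q z =
     (if z \<le> overlap_mass W P Q then overlap_pmf W P Q else excess_pmf W P Q)"

text \<open>
  The \<open>W\<close>-valued random variable \<open>w\<close> is the result of a randomized procedure with output
  distributions \<open>K\<close>, run on the random input \<open>\<zeta>\<close> with sampling randomness independent of \<open>\<zeta>\<close>: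
  the conditional law of \<open>w\<close> given \<open>\<zeta> = z\<close> is \<open>K z\<close>. Values of \<open>K\<close> at inputs that \<open>\<zeta>\<close> takes with
  probability zero play no role.
\<close>
definition sampled_given ::
    "'a measure \<Rightarrow> 'w set \<Rightarrow> (real \<Rightarrow> 'w pmf) \<Rightarrow> ('a \<Rightarrow> real) \<Rightarrow> ('a \<Rightarrow> 'w) \<Rightarrow> bool" where
  "sampled_given M W K \<zeta> w \<longleftrightarrow>
     w \<in> measurable M (count_space W) \<and>
     (\<forall>A\<in>sets borel. \<forall>v\<in>W.
        measure M {\<omega> \<in> space M. \<zeta> \<omega> \<in> A \<and> w \<omega> = v} =
        (\<integral>\<omega>. indicator A (\<zeta> \<omega>) * pmf (K (\<zeta> \<omega>)) v \<partial>M))"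

text \<open>
  In particular, \<open>w\<close> may be produced by selecting, according to \<open>\<zeta>\<close>, one of two samples \<open>X\<close> and \<open>Y\<close>
  that are independent of \<open>\<zeta>\<close>; a sample whose distribution cannot be normalized is arbitrary.
\<close>
lemma sampled_given_maximal_couplingI:
  fixes M :: "'a measure" and \<zeta> :: "'a \<Rightarrow> real" and P Q :: "'w pmf"
  assumes "prob_space M" and W: "finite W" "set_pmf P \<subseteq> W"
    and \<zeta>m [measurable]: "\<zeta> \<in> borel_measurable M"
    and unif: "distr M borel \<zeta> = uniform_measure lborel {0..1}"
    and Xm [measurable]: "X \<in> measurable M (count_space W)"
    and indX: "prob_space.indep_set M (sets (vimage_algebra (space M) \<zeta> borel))
                (sets (vimage_algebra (space M) X (count_space W)))"
    and Ym [measurable]: "Y \<in> measurable M (count_space W)"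
    and indY: "prob_space.indep_set M (sets (vimage_algebra (space M) \<zeta> borel))
                (sets (vimage_algebra (space M) Y (count_space W)))"
    and X: "overlap_mass W P Q > 0 \<Longrightarrow> distr M (count_space UNIV) X = measure_pmf (overlap_pmf W P Q)"
    and Y: "overlap_mass W P Q < 1 \<Longrightarrow> distr M (count_space UNIV) Y = measure_pmf (excess_pmf W P Q)"
    and w: "\<And>\<omega>. w \<omega> = (if \<zeta> \<omega> \<le> overlap_mass W P Q then X \<omega> else Y \<omega>)"
  shows "sampled_given M W (maximal_coupling W P Q) \<zeta> w"
proof -
  interpret prob_space M by fact
  define p where "p = overlap_mass W P Q"
  have p0: "0 \<le> p"
    unfolding p_def overlap_mass_def by (intro sum_nonneg) auto
  have "p \<le> (\<Sum>v\<in>W. pmf P v)"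
    unfolding p_def overlap_mass_def by (intro sum_mono) auto
  also have "\<dots> = 1"
    using W by (rule sum_pmf_eq_1)
  finally have p1: "p \<le> 1" .
  have law: "measure M {\<omega> \<in> space M. \<zeta> \<omega> \<in> A} = measure lborel ({0..1} \<inter> A)"
    if [measurable]: "A \<in> sets borel" for A
  proof -
    have "measure M {\<omega> \<in> space M. \<zeta> \<omega> \<in> A} = measure (distr M borel \<zeta>) A"
      by (subst measure_distr) (auto intro!: arg_cong[where f = "measure M"])
    also have "\<dots> = measure lborel ({0..1} \<inter> A)"
      unfolding unif by (subst measure_uniform_measure) auto
    finally show ?thesis .
  qed
  have point: "measure M {\<omega> \<in> space M. Z \<omega> = v} = pmf D v"
    if Z: "Z \<in> measurable M (count_space W)" "distr M (count_space UNIV) Z = measure_pmf D"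
    and v: "v \<in> W" for Z D v
  proof -
    have Zm: "Z \<in> measurable M (count_space UNIV)"
      by (rule measurable_compose[OF Z(1), where g = "\<lambda>x. x"]) simp
    have "pmf D v = measure (distr M (count_space UNIV) Z) {v}"
      unfolding Z(2) by (simp add: measure_pmf_single)
    also have "\<dots> = measure M (Z -` {v} \<inter> space M)"
      by (subst measure_distr) (use Zm in auto)
    also have "Z -` {v} \<inter> space M = {\<omega> \<in> space M. Z \<omega> = v}" by auto
    finally show ?thesis by simp
  qed
  have wm: "w \<in> measurable M (count_space W)"
  proof -
    have "w = (\<lambda>\<omega>. if \<zeta> \<omega> \<le> p then X \<omega> else Y \<omega>)"
      using w by (auto simp: p_def)
    then show ?thesis by simp
  qed
  have prodI: "measure M {\<omega> \<in> space M. \<zeta> \<omega> \<in> A \<and> Z \<omega> = v} =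
      measure M {\<omega> \<in> space M. \<zeta> \<omega> \<in> A} * measure M {\<omega> \<in> space M. Z \<omega> = v}"
    if ind: "indep_set (sets (vimage_algebra (space M) \<zeta> borel))
        (sets (vimage_algebra (space M) Z (count_space W)))"
      and Av: "A \<in> sets borel" "v \<in> W" for Z A v
  proof -
    have "measure M ((\<zeta> -` A \<inter> space M) \<inter> (Z -` {v} \<inter> space M)) =
        measure M (\<zeta> -` A \<inter> space M) * measure M (Z -` {v} \<inter> space M)"
      using Av by (intro indep_setD[OF ind] in_vimage_algebra) auto
    moreover have "(\<zeta> -` A \<inter> space M) \<inter> (Z -` {v} \<inter> space M) =
        {\<omega> \<in> space M. \<zeta> \<omega> \<in> A \<and> Z \<omega> = v}"
      "\<zeta> -` A \<inter> space M = {\<omega> \<in> space M. \<zeta> \<omega> \<in> A}" "Z -` {v} \<inter> space M = {\<omega> \<in> space M. Z \<omega> = v}"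
      by auto
    ultimately show ?thesis by simp
  qed
  have main: "measure M {\<omega> \<in> space M. \<zeta> \<omega> \<in> A \<and> w \<omega> = v} =
        (\<integral>\<omega>. indicator A (\<zeta> \<omega>) * pmf (maximal_coupling W P Q (\<zeta> \<omega>)) v \<partial>M)"
    if A [measurable]: "A \<in> sets borel" and v: "v \<in> W" for A v
  proof -
    let ?a = "pmf (overlap_pmf W P Q) v" and ?b = "pmf (excess_pmf W P Q) v"
    let ?S = "{\<omega> \<in> space M. \<zeta> \<omega> \<in> A \<inter> {..p}}" and ?T = "{\<omega> \<in> space M. \<zeta> \<omega> \<in> A \<inter> {p<..}}"
    have [measurable]: "?S \<in> sets M" "?T \<in> sets M" by measurable
    have int: "integrable M (indicator ?S :: 'a \<Rightarrow> real)" "integrable M (indicator ?T :: 'a \<Rightarrow> real)"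
      by (auto intro!: integrable_real_indicator simp: emeasure_eq_measure simp del: Int_iff)
    have "(\<integral>\<omega>. indicator A (\<zeta> \<omega>) * pmf (maximal_coupling W P Q (\<zeta> \<omega>)) v \<partial>M) =
        (\<integral>\<omega>. indicator ?S \<omega> * ?a + indicator ?T \<omega> * ?b \<partial>M)"
      by (intro Bochner_Integration.integral_cong)
        (auto simp: maximal_coupling_def p_def[symmetric] indicator_def)
    also have "\<dots> = measure M ?S * ?a + measure M ?T * ?b"
      using int by (subst Bochner_Integration.integral_add) auto
    also have "measure M ?S * ?a = measure M {\<omega> \<in> space M. \<zeta> \<omega> \<in> A \<inter> {..p} \<and> X \<omega> = v}"
    proof (cases "p = 0")
      case True
      have "measure M ?S = measure lborel ({0..1} \<inter> (A \<inter> {..p}))"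
        by (rule law) auto
      also have "\<dots> \<le> measure lborel {0..0::real}"
        using True by (intro measure_mono_fmeasurable) (auto intro: fmeasurableI)
      finally have "measure M ?S = 0" by (simp add: measure_le_0_iff)
      then show ?thesis
        using indX v by (subst prodI) auto
    next
      case False
      then show ?thesis
        using indX v p0 X by (subst prodI) (auto simp: point[OF Xm] p_def)
    qed
    also have "measure M ?T * ?b = measure M {\<omega> \<in> space M. \<zeta> \<omega> \<in> A \<inter> {p<..} \<and> Y \<omega> = v}"
    proof (cases "p = 1")
      case True
      have "measure M ?T = measure lborel ({0..1} \<inter> (A \<inter> {p<..}))"
        by (rule law) auto
      also have "{0..1} \<inter> (A \<inter> {p<..}) = {}" using True by auto
      finally have "measure M ?T = 0" by simp
      then show ?thesis
        using indY v by (subst prodI) auto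
    next
      case False
      then show ?thesis
        using indY v p1 Y by (subst prodI) (auto simp: point[OF Ym] p_def)
    qed
    also have "measure M {\<omega> \<in> space M. \<zeta> \<omega> \<in> A \<inter> {..p} \<and> X \<omega> = v} +
        measure M {\<omega> \<in> space M. \<zeta> \<omega> \<in> A \<inter> {p<..} \<and> Y \<omega> = v} =
        measure M ({\<omega> \<in> space M. \<zeta> \<omega> \<in> A \<inter> {..p} \<and> X \<omega> = v} \<union>
          {\<omega> \<in> space M. \<zeta> \<omega> \<in> A \<inter> {p<..} \<and> Y \<omega> = v})"
      using v by (intro finite_measure_Union[symmetric]) auto
    also have "{\<omega> \<in> space M. \<zeta> \<omega> \<in> A \<inter> {..p} \<and> X \<omega> = v} \<union>
          {\<omega> \<in> space M. \<zeta> \<omega> \<in> A \<inter> {p<..} \<and> Y \<omega> = v} = {\<omega> \<in> space M. \<zeta> \<omega> \<in> A \<and> w \<omega> = v}"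
      by (auto simp: w p_def)
    finally show ?thesis by simp
  qed
  from wm main show ?thesis unfolding sampled_given_def by auto
qed

end

theory Submission
  imports Defs
begin

text \<open>
  The output \<open>v\<close> has probability \<open>p\<close> times its normalized overlap plus \<open>1 - p\<close> times its normalized
  excess. The total overlap is \<open>p\<close> and the total excess is \<open>1 - p\<close>, so the normalizations cancel and
  leave \<open>min (P v) (Q v) + max 0 (P v - Q v) = P v\<close>.
\<close>

text \<open>The product form covers a zero total as well: \<open>normalized_pmf W f\<close> is then
  unspecified, but nonnegative weights with sum zero all vanish, so both sides are 0. Hence the
  cases \<open>p = 0\<close> and \<open>p = 1\<close> need no separate treatment later.\<close>

lemma sum_mult_pmf_normalized_pmf:
  assumes "finite W" and nonneg: "\<And>u. u \<in> W \<Longrightarrow> 0 \<le> f u" and v: "v \<in> W"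
  shows "sum f W * pmf (normalized_pmf W f) v = f v"
proof (cases "sum f W = 0")
  case True
  with assms show ?thesis by (simp add: sum_nonneg_eq_0_iff)
next
  case False
  let ?g = "\<lambda>v. if v \<in> W then f v / sum f W else 0"
  have pos: "0 \<le> ?g x" for x
    using nonneg by (auto intro!: divide_nonneg_nonneg sum_nonneg)
  \<comment> \<open>\<open>pmf_embed_pmf\<close> asks for total mass 1 over the whole type; as
    \<open>?g\<close> vanishes off \<open>W\<close>, this reduces to a finite sum.\<close>
  have "(\<integral>\<^sup>+x. ennreal (?g x) \<partial>count_space UNIV) = (\<integral>\<^sup>+x. ennreal (?g x) \<partial>count_space W)"
    by (subst nn_integral_count_space_indicator)
      (auto intro!: nn_integral_cong simp: indicator_def)
  also have "\<dots> = (\<Sum>x\<in>W. ennreal (?g x))"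
    using \<open>finite W\<close> by (rule nn_integral_count_space_finite)
  also have "\<dots> = ennreal (\<Sum>x\<in>W. ?g x)"
    by (rule sum_ennreal) (rule pos)
  also have "(\<Sum>x\<in>W. ?g x) = 1"
    using False by (simp flip: sum_divide_distrib)
  finally have "pmf (normalized_pmf W f) v = ?g v"
    unfolding normalized_pmf_def by (subst pmf_embed_pmf) (use pos in auto)
  with False v show ?thesis by simp
qed

text \<open>Termwise max(0, a - b) = a - min(a, b), and \<open>P\<close> has total mass 1 on
  \<open>W\<close> because its support lies there.\<close>

lemma sum_excess_eq:
  assumes "finite W" and "set_pmf P \<subseteq> W"
  shows "(\<Sum>v\<in>W. max 0 (pmf P v - pmf Q v)) = 1 - overlap_mass W P Q"
proof -
  have "(\<Sum>v\<in>W. max 0 (pmf P v - pmf Q v)) = (\<Sum>v\<in>W. pmf P v - min (pmf P v) (pmf Q v))"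
    by (intro sum.cong) auto
  also have "\<dots> = 1 - overlap_mass W P Q"
    using sum_pmf_eq_1[OF assms] by (simp add: sum_subtractf overlap_mass_def)
  finally show ?thesis .
qed

lemma overlap_mass_bounds:
  assumes "finite W" and "set_pmf P \<subseteq> W"
  shows "0 \<le> overlap_mass W P Q" and "overlap_mass W P Q \<le> 1"
proof -
  show "0 \<le> overlap_mass W P Q"
    unfolding overlap_mass_def by (intro sum_nonneg) auto
  \<comment> \<open>The upper bound comes from the excess mass \<open>1 - p\<close> being
    nonnegative.\<close>
  have "0 \<le> (\<Sum>v\<in>W. max 0 (pmf P v - pmf Q v))"
    by (intro sum_nonneg) auto
  then show "overlap_mass W P Q \<le> 1"
    using sum_excess_eq[OF assms] by simp
qed

text \<open>For \<open>p\<close> in the unit interval, a uniform variable is at most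
  \<open>p\<close> with probability exactly \<open>p\<close>; the integrand is a combination of the
  indicators of the two sides of the threshold.\<close>

lemma integral_uniform_threshold:
  fixes a b p :: real
  assumes "0 \<le> p" and "p \<le> 1"
  shows "(\<integral>z. (if z \<le> p then a else b) \<partial>uniform_measure lborel {0..1}) = p * a + (1 - p) * b"
proof -
  interpret prob_space "uniform_measure lborel {0..1::real}"
    by (rule prob_space_uniform_measure) auto
  have "prob {..p} = p"
    using assms by (subst measure_uniform_measure) (auto simp: Int_atMost)
  moreover have "prob {p<..} = 1 - p"
    using prob_compl[of "{..p}"] \<open>prob {..p} = p\<close> by (simp add: Compl_atMost flip: Compl_eq_Diff_UNIV)
  moreover have "(\<integral>z. (if z \<le> p then a else b) \<partial>uniform_measure lborel {0..1}) =
      (\<integral>z. indicator {..p} z * a + indicator {p<..} z * b \<partial>uniform_measure lborel {0..1})"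
    by (intro Bochner_Integration.integral_cong) auto
  moreover have "integrable (uniform_measure lborel {0..1}) (indicator {..p} :: real \<Rightarrow> real)"
    "integrable (uniform_measure lborel {0..1}) (indicator {p<..} :: real \<Rightarrow> real)"
    by (auto intro!: integrable_real_indicator simp: emeasure_eq_measure)
  ultimately show ?thesis by (subst (asm) Bochner_Integration.integral_add) auto
qed

theorem lemma2p2:
  fixes M :: "'a measure" and W :: "'w set" and P Q :: "'w pmf"
    and \<zeta> :: "'a \<Rightarrow> real" and w :: "'a \<Rightarrow> 'w"
  assumes "prob_space M"
    and "finite W" and "set_pmf P \<subseteq> W" and "set_pmf Q \<subseteq> W"
    and "\<zeta> \<in> borel_measurable M"
    and "distr M borel \<zeta> = uniform_measure lborel {0..1}"
    and "sampled_given M W (maximal_coupling W P Q) \<zeta> w"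
  shows "distr M (count_space UNIV) w = measure_pmf P"
proof -
  interpret prob_space M by fact
  note W = \<open>finite W\<close> \<open>set_pmf P \<subseteq> W\<close>
  note [measurable] = \<open>\<zeta> \<in> borel_measurable M\<close>
  let ?p = "overlap_mass W P Q"
  have wW: "w \<in> measurable M (count_space W)"
    using assms(7) by (simp add: sampled_given_def)
  have [measurable]: "w \<in> measurable M (count_space UNIV)"
    by (rule measurable_compose[OF wW, where g = "\<lambda>x. x"]) simp
  have law: "measure M {\<omega> \<in> space M. w \<omega> = v} = pmf P v" if v: "v \<in> W" for v
  proof -
    let ?h = "\<lambda>z. if z \<le> ?p then pmf (overlap_pmf W P Q) v else pmf (excess_pmf W P Q) v"
    \<comment> \<open>Taking the event \<open>A = UNIV\<close> in \<open>sampled_given\<close>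
      removes the condition on \<zeta> and leaves the marginal of \<open>w\<close>.\<close>
    have "measure M {\<omega> \<in> space M. w \<omega> = v} =
        (\<integral>\<omega>. pmf (maximal_coupling W P Q (\<zeta> \<omega>)) v \<partial>M)"
      using assms(7) v unfolding sampled_given_def by (force dest: bspec[where x = UNIV])
    also have "\<dots> = (\<integral>\<omega>. ?h (\<zeta> \<omega>) \<partial>M)"
      by (intro Bochner_Integration.integral_cong) (auto simp: maximal_coupling_def)
    \<comment> \<open>The integrand depends on the sample point only through \<zeta>, so the
      integral passes to the law of \<zeta>.\<close>
    also have "\<dots> = (\<integral>z. ?h z \<partial>uniform_measure lborel {0..1})"
      unfolding assms(6)[symmetric] by (rule integral_distr[symmetric]) measurable
    also have "\<dots> = ?p * pmf (overlap_pmf W P Q) v + (1 - ?p) * pmf (excess_pmf W P Q) v"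
      by (intro integral_uniform_threshold overlap_mass_bounds W)
    also have "?p * pmf (overlap_pmf W P Q) v = min (pmf P v) (pmf Q v)"
      unfolding overlap_mass_def overlap_pmf_def
      using W(1) v by (subst sum_mult_pmf_normalized_pmf) auto
    \<comment> \<open>\<open>1 - ?p\<close> is rewritten as the total excess, the normalizing
      constant of \<open>excess_pmf\<close>.\<close>
    also have "(1 - ?p) * pmf (excess_pmf W P Q) v = max 0 (pmf P v - pmf Q v)"
      unfolding excess_pmf_def sum_excess_eq[OF W, symmetric]
      using W(1) v by (subst sum_mult_pmf_normalized_pmf) auto
    finally show ?thesis by (simp add: min_def max_def split: if_splits)
  qed
  show ?thesis
  \<comment> \<open>The type of outcomes may be uncountable, but both laws are concentrated on the
    finite set \<open>W\<close>, so agreement on its singletons suffices.\<close>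
  proof (rule measure_eqI_countable_AE[where \<Omega> = W])
    show "AE v in distr M (count_space UNIV) w. v \<in> W"
      using measurable_space[OF wW] by (subst AE_distr_iff) auto
    show "AE v in measure_pmf P. v \<in> W"
      using W by (auto simp: AE_measure_pmf_iff)
    fix v assume "v \<in> W"
    have "emeasure (distr M (count_space UNIV) w) {v} = emeasure M {\<omega> \<in> space M. w \<omega> = v}"
      by (subst emeasure_distr) (auto intro!: arg_cong[where f = "emeasure M"])
    also have "\<dots> = emeasure (measure_pmf P) {v}"
      using law[OF \<open>v \<in> W\<close>] by (simp add: emeasure_eq_measure emeasure_pmf_single)
    finally show "emeasure (distr M (count_space UNIV) w) {v} = emeasure (measure_pmf P) {v}" .
  qed (use W in \<open>auto intro: countable_finite\<close>)
qed

end
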